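(* For every finite matroid $M$, the set of friendly separations of $M$ is a nested set of separations; and hence it gives rise to a tree-decomposition of $M$ that efficiently distinguishes every pair of distinguishable tangles of $M$.
   Context: Let $M$ be a finite matroid with ground set $E$ and rank function $r$. A separation of $M$ is a set $\{A,B\}$ with $A\cup B=E$ and $A\cap B=\emptyset$; its order is $|\{A,B\}|=r(A)+r(B)-r(E)$. Two separations $\{A,B\},\{C,D\}$ are nested if, after possibly renaming sides, $A\subseteq C$ and $B\supseteq D$; otherwise they cross; a set of separations is nested if its elements are pairwise nested. For crossing $\{A,B\},\{C,D\}$ the corners are $\{X\cap Y,X'\cup Y'\}$ for $\{X,X'\}=\{A,B\}$, $\{Y,Y'\}=\{C,D\}$; two corners lie on the same side of $\{A,B\}$ if they use the same $X$. An entanglement of $M$ is a non-empty set $\varepsilon$ of separations such that: if $r\in\varepsilon$ is crossed by a separation $s$ of $M$ so that two corners on the same side of $r$ have order at most $|r|$, then at least one of them has order equal to $|r|$ and lies in $\varepsilon$. A separation is friendly if it lies in some entanglement $\varepsilon$ such that no other separation in $\varepsilon$ crosses fewer separations lying in entanglements of $M$ than it does. An oriented separation is an ordered pair $(A,B)$ with $\{A,B\}$ a separation. A tangle of order $k$ of $M$ is a set $\tau$ of oriented separations of order $<k$ containing exactly one of $(A,B),(B,A)$ for each separation of order $<k$, such that there are no $(A_1,B_1),(A_2,B_2),(A_3,B_3)\in\tau$ (not necessarily distinct) with $A_1\cup A_2\cup A_3=E$. A separation $\{A,B\}$ distinguishes tangles $\tau,\tau'$ if $(A,B)\in\tau,(B,A)\in\tau'$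 or vice versa; efficiently if its order is minimum among all distinguishing separations; tangles are distinguishable if some separation distinguishes them. A tree-decomposition of $M$ is a tree $T$ with a map $\varphi\colon E\to V(T)$; each edge $e$ of $T$ induces the separation $\{\varphi^{-1}(V(T_1)),\varphi^{-1}(V(T_2))\}$ where $T_1,T_2$ are the components of $T-e$; it efficiently distinguishes a pair of tangles if some edge-induced separation efficiently distinguishes them. *)

theory Defs
  imports Main
begin

section \<open>Finite matroids and their separations\<close>

locale matroid =
  fixes E :: "'a set" and indep :: "'a set \<Rightarrow> bool"
  assumes finite_ground: "finite E"
    and indep_subset_ground: "indep X \<Longrightarrow> X \<subseteq> E"
    and indep_empty: "indep {}"
    and indep_subset: "indep X \<Longrightarrow> Y \<subseteq> X \<Longrightarrow> indep Y"
    and indep_augment: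
      "indep X \<Longrightarrow> indep Y \<Longrightarrow> card X < card Y \<Longrightarrow> \<exists>y \<in> Y - X. indep (insert y X)"
begin

definition rk :: "'a set \<Rightarrow> nat" where
  "rk A = Max {card X | X. X \<subseteq> A \<and> indep X}"

definition oriented_sep :: "'a set \<Rightarrow> 'a set \<Rightarrow> bool" where
  "oriented_sep A B \<longleftrightarrow> A \<union> B = E \<and> A \<inter> B = {}"

definition separations :: "'a set set set" where
  "separations = {{A, B} | A B. oriented_sep A B}"

text \<open>
  For \<open>s = {A, B}\<close> this is \<open>r(A) + r(B) - r(E)\<close>, see \<open>sep_order_pair\<close> below. The two sides
  can coincide only if \<open>E\<close> is empty, and then all ranks are zero.
\<close>
definition sep_order :: "'a set set \<Rightarrow> int" where
  "sep_order s = (\<Sum>X\<in>s. int (rk X)) - int (rk E)"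

lemma sep_order_pair:
  assumes "oriented_sep A B"
  shows "sep_order {A, B} = int (rk A) + int (rk B) - int (rk E)"
proof (cases "A = B")
  case True
  with assms have eq: "A = {}" "B = {}" and E: "E = {}" by (auto simp: oriented_sep_def)
  have "{card X | X. X \<subseteq> {} \<and> indep X} = {0}" using indep_empty by auto
  then have "rk {} = 0" unfolding rk_def by simp
  with E have "rk E = 0" by simp
  then show ?thesis unfolding sep_order_def eq using \<open>rk {} = 0\<close> by simp
qed (simp add: sep_order_def)

definition nested :: "'a set set \<Rightarrow> 'a set set \<Rightarrow> bool" where
  "nested s t \<longleftrightarrow> (\<exists>A B C D. s = {A, B} \<and> t = {C, D} \<and> A \<subseteq> C \<and> D \<subseteq> B)"

abbreviation crosses :: "'a set set \<Rightarrow> 'a set set \<Rightarrow> bool" where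
  "crosses s t \<equiv> \<not> nested s t"

definition nested_set :: "'a set set set \<Rightarrow> bool" where
  "nested_set N \<longleftrightarrow> N \<subseteq> separations \<and> pairwise nested N"

subsection \<open>Entanglements and friendly separations\<close>

text \<open>The corner of \<open>{X, X'}\<close> and \<open>{Y, Y'}\<close> that uses the sides \<open>X\<close> and \<open>Y\<close>.\<close>
definition corner :: "'a set \<Rightarrow> 'a set \<Rightarrow> 'a set \<Rightarrow> 'a set \<Rightarrow> 'a set set" where
  "corner X X' Y Y' = {X \<inter> Y, X' \<union> Y'}"

text \<open>
  Below, \<open>r = {X, X'}\<close> and \<open>s = {Y, Y'}\<close>; the two corners on the side \<open>X\<close> of \<open>r\<close> are
  \<open>corner X X' Y Y'\<close> and \<open>corner X X' Y' Y\<close>.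
\<close>
definition entanglement :: "'a set set set \<Rightarrow> bool" where
  "entanglement \<epsilon> \<longleftrightarrow>
     \<epsilon> \<noteq> {} \<and> \<epsilon> \<subseteq> separations \<and>
     (\<forall>r\<in>\<epsilon>. \<forall>s\<in>separations. crosses r s \<longrightarrow>
        (\<forall>X X' Y Y'. r = {X, X'} \<and> s = {Y, Y'} \<and>
           sep_order (corner X X' Y Y') \<le> sep_order r \<and>
           sep_order (corner X X' Y' Y) \<le> sep_order r \<longrightarrow>
           (\<exists>c \<in> {corner X X' Y Y', corner X X' Y' Y}. sep_order c = sep_order r \<and> c \<in> \<epsilon>)))"

definition crossing_number :: "'a set set \<Rightarrow> nat" where
  "crossing_number s = card {t. (\<exists>\<epsilon>. entanglement \<epsilon> \<and> t \<in> \<epsilon>) \<and> crosses s t}"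

definition friendly :: "'a set set \<Rightarrow> bool" where
  "friendly s \<longleftrightarrow>
     (\<exists>\<epsilon>. entanglement \<epsilon> \<and> s \<in> \<epsilon> \<and> \<not> (\<exists>t\<in>\<epsilon>. t \<noteq> s \<and> crossing_number t < crossing_number s))"

subsection \<open>Tangles\<close>

definition tangle :: "nat \<Rightarrow> ('a set \<times> 'a set) set \<Rightarrow> bool" where
  "tangle k \<tau> \<longleftrightarrow>
     (\<forall>(A, B)\<in>\<tau>. oriented_sep A B \<and> sep_order {A, B} < int k) \<and>
     (\<forall>A B. oriented_sep A B \<and> sep_order {A, B} < int k \<longrightarrow>
        (\<exists>!p. p \<in> {(A, B), (B, A)} \<and> p \<in> \<tau>)) \<and>
     \<not> (\<exists>A\<^sub>1 B\<^sub>1 A\<^sub>2 B\<^sub>2 A\<^sub>3 B\<^sub>3. (A\<^sub>1, B\<^sub>1) \<in> \<tau> \<and> (A\<^sub>2, B\<^sub>2) \<in> \<tau> \<and> (A\<^sub>3, B\<^sub>3) \<in> \<tau> \<and>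
          A\<^sub>1 \<union> A\<^sub>2 \<union> A\<^sub>3 = E)"

definition distinguishes ::
  "'a set set \<Rightarrow> ('a set \<times> 'a set) set \<Rightarrow> ('a set \<times> 'a set) set \<Rightarrow> bool" where
  "distinguishes s \<tau> \<tau>' \<longleftrightarrow>
     (\<exists>A B. oriented_sep A B \<and> s = {A, B} \<and>
        ((A, B) \<in> \<tau> \<and> (B, A) \<in> \<tau>' \<or> (B, A) \<in> \<tau> \<and> (A, B) \<in> \<tau>'))"

definition efficiently_distinguishes ::
  "'a set set \<Rightarrow> ('a set \<times> 'a set) set \<Rightarrow> ('a set \<times> 'a set) set \<Rightarrow> bool" where
  "efficiently_distinguishes s \<tau> \<tau>' \<longleftrightarrow>
     distinguishes s \<tau> \<tau>' \<and> (\<forall>t. distinguishes t \<tau> \<tau>' \<longrightarrow> sep_order s \<le> sep_order t)"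

definition distinguishable :: "('a set \<times> 'a set) set \<Rightarrow> ('a set \<times> 'a set) set \<Rightarrow> bool" where
  "distinguishable \<tau> \<tau>' \<longleftrightarrow> (\<exists>s. distinguishes s \<tau> \<tau>')"

end

section \<open>Trees\<close>

text \<open>
  Graphs are undirected and simple, given by a vertex set \<open>V\<close> and a set \<open>F\<close> of two-element
  subsets of \<open>V\<close>.
\<close>
definition simple_graph :: "'v set \<Rightarrow> 'v set set \<Rightarrow> bool" where
  "simple_graph V F \<longleftrightarrow> (\<forall>e\<in>F. e \<subseteq> V \<and> card e = 2)"

definition graph_component :: "'v set \<Rightarrow> 'v set set \<Rightarrow> 'v \<Rightarrow> 'v set" where
  "graph_component V F u = {w \<in> V. (u, w) \<in> {(x, y). {x, y} \<in> F}\<^sup>*}"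

definition graph_components :: "'v set \<Rightarrow> 'v set set \<Rightarrow> 'v set set" where
  "graph_components V F = graph_component V F ` V"

definition graph_cycle :: "'v set set \<Rightarrow> 'v list \<Rightarrow> bool" where
  "graph_cycle F xs \<longleftrightarrow>
     3 \<le> length xs \<and> distinct xs \<and> (\<forall>i < length xs. {xs ! i, xs ! (Suc i mod length xs)} \<in> F)"

definition graph_tree :: "'v set \<Rightarrow> 'v set set \<Rightarrow> bool" where
  "graph_tree V F \<longleftrightarrow>
     simple_graph V F \<and> V \<noteq> {} \<and> (\<forall>u\<in>V. graph_component V F u = V) \<and> \<not> (\<exists>xs. graph_cycle F xs)"

section \<open>Tree-decompositions\<close>

context matroid
begin

definition tree_decomposition :: "'v set \<Rightarrow> 'v set set \<Rightarrow> ('a \<Rightarrow> 'v) \<Rightarrow> bool" where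
  "tree_decomposition V F \<phi> \<longleftrightarrow> graph_tree V F \<and> \<phi> ` E \<subseteq> V"

text \<open>
  If \<open>(V, F)\<close> is a tree and \<open>e \<in> F\<close>, then \<open>T - e\<close> has exactly two components, so this is the
  two-element family of their preimages under \<open>\<phi>\<close> (a single empty set if \<open>E\<close> is empty).
\<close>
definition induced_sep :: "'v set \<Rightarrow> 'v set set \<Rightarrow> ('a \<Rightarrow> 'v) \<Rightarrow> 'v set \<Rightarrow> 'a set set" where
  "induced_sep V F \<phi> e = (\<lambda>C. {x \<in> E. \<phi> x \<in> C}) ` graph_components V (F - {e})"

definition td_efficiently_distinguishes ::
  "'v set \<Rightarrow> 'v set set \<Rightarrow> ('a \<Rightarrow> 'v) \<Rightarrow>
    ('a set \<times> 'a set) set \<Rightarrow> ('a set \<times> 'a set) set \<Rightarrow> bool" where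
  "td_efficiently_distinguishes V F \<phi> \<tau> \<tau>' \<longleftrightarrow>
     (\<exists>e\<in>F. efficiently_distinguishes (induced_sep V F \<phi> e) \<tau> \<tau>')"

end

end

theory Submission
  imports Defs
begin

text \<open>
  Let two friendly separations \<open>r\<close>, \<open>s\<close> cross. A separation crossing a corner crosses \<open>r\<close> or \<open>s\<close>,
  one crossing two opposite corners crosses both, and neither \<open>r\<close> nor \<open>s\<close> crosses a corner. So
  opposite corners together have a smaller crossing number than \<open>r\<close> and \<open>s\<close> together, while
  submodularity bounds their orders. The entanglements then provide corners whose crossing numbers
  contradict the choice of \<open>r\<close> and \<open>s\<close>. The separations that efficiently distinguish two tangles
  form an entanglement, which contains a friendly separation by taking the crossing number
  minimal. The tree is built by attaching one leaf for each separation, whose part is an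
  inclusion-minimal side.
\<close>

section \<open>Rank and order\<close>

context matroid
begin

lemma finite_indep: "indep X \<Longrightarrow> finite X"
  using finite_ground finite_subset indep_subset_ground by blast

lemma finite_indep_cards: "finite {card X | X. X \<subseteq> A \<and> indep X}"
proof (rule finite_subset)
  show "{card X | X. X \<subseteq> A \<and> indep X} \<subseteq> card ` Pow E" using indep_subset_ground by auto
qed (simp add: finite_ground)

lemma card_le_rk: "X \<subseteq> A \<Longrightarrow> indep X \<Longrightarrow> card X \<le> rk A"
  unfolding rk_def by (rule Max_ge[OF finite_indep_cards]) blast

lemma rk_attained: "\<exists>X. X \<subseteq> A \<and> indep X \<and> card X = rk A"
proof -
  have "{card X | X. X \<subseteq> A \<and> indep X} \<noteq> {}" using indep_empty by auto
  from Max_in[OF finite_indep_cards this] show ?thesis unfolding rk_def by auto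
qed

text \<open>Augmentation against a largest independent subset of \<open>A\<close> adds one element
  at a time; the induction is on the number of elements still missing.\<close>

lemma extend_to_basis:
  assumes "indep I" "I \<subseteq> A"
  shows "\<exists>J. I \<subseteq> J \<and> J \<subseteq> A \<and> indep J \<and> card J = rk A"
  using assms
proof (induction "rk A - card I" arbitrary: I rule: less_induct)
  case less
  show ?case
  proof (cases "card I < rk A")
    case True
    obtain K where K: "K \<subseteq> A" "indep K" "card K = rk A" using rk_attained by blast
    obtain y where y: "y \<in> K - I" "indep (insert y I)"
      using indep_augment[OF less.prems(1) K(2)] K(3) True by auto
    have "card (insert y I) = Suc (card I)" using y finite_indep[OF less.prems(1)] by simp
    with True have "rk A - card (insert y I) < rk A - card I" by simp
    moreover have "insert y I \<subseteq> A" using y K less.prems by blast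
    ultimately obtain J where "insert y I \<subseteq> J" "J \<subseteq> A" "indep J" "card J = rk A"
      using less.hyps[OF _ y(2)] by blast
    then show ?thesis by blast
  next
    case False
    then have "card I = rk A" using card_le_rk[OF less.prems(2,1)] by simp
    then show ?thesis using less.prems by blast
  qed
qed

text \<open>A basis \<open>I\<close> of the intersection extends to a basis \<open>J\<close> of the
  union. The independent sets \<open>J \<inter> A\<close> and \<open>J \<inter> B\<close> have union
  \<open>J\<close>, and their intersection contains \<open>I\<close>, so counting their elements
  gives the bound.\<close>

lemma rk_submodular: "rk (A \<inter> B) + rk (A \<union> B) \<le> rk A + rk B"
proof -
  obtain I where I: "I \<subseteq> A \<inter> B" "indep I" "card I = rk (A \<inter> B)" using rk_attained by blast
  obtain J where J: "I \<subseteq> J" "J \<subseteq> A \<union> B" "indep J" "card J = rk (A \<union> B)"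
    using extend_to_basis[of I "A \<union> B"] I by blast
  have fin: "finite J" using J finite_indep by blast
  have "card J + card I \<le> card J + card (J \<inter> A \<inter> (J \<inter> B))"
    using I J fin by (intro add_left_mono card_mono) auto
  also have "\<dots> = card (J \<inter> A \<union> J \<inter> B) + card (J \<inter> A \<inter> (J \<inter> B))"
    using J(2) by (simp add: Int_Un_distrib[symmetric] Int_absorb2)
  also have "\<dots> = card (J \<inter> A) + card (J \<inter> B)"
    by (rule card_Un_Int[symmetric]) (use fin in auto)
  also have "\<dots> \<le> rk A + rk B"
    by (intro add_mono card_le_rk indep_subset[OF J(3)]) auto
  finally show ?thesis using I J by simp
qed

section \<open>Corners\<close>

lemma oriented_sep_iff: "oriented_sep A B \<longleftrightarrow> A \<subseteq> E \<and> B = E - A"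
  by (auto simp: oriented_sep_def)

lemma oriented_sep_commute: "oriented_sep A B \<longleftrightarrow> oriented_sep B A"
  by (auto simp: oriented_sep_def)

lemma oriented_sep_corner:
  "oriented_sep A B \<Longrightarrow> oriented_sep C D \<Longrightarrow> oriented_sep (A \<inter> C) (B \<union> D)"
  by (auto simp: oriented_sep_def)

lemma corner_commute: "corner A B C D = corner C D A B"
  by (simp add: corner_def Int_commute Un_commute)

lemma separationsE:
  assumes "s \<in> separations"
  obtains A B where "s = {A, B}" "oriented_sep A B"
  using assms by (auto simp: separations_def)

lemma oriented_sep_in_separations: "oriented_sep A B \<Longrightarrow> {A, B} \<in> separations"
  by (auto simp: separations_def)

lemma oriented_sep_of_separations: "{A, B} \<in> separations \<Longrightarrow> oriented_sep A B"
  by (auto simp: separations_def doubleton_eq_iff oriented_sep_commute)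

lemma finite_separations: "finite separations"
proof (rule finite_subset)
  show "separations \<subseteq> Pow (Pow E)" by (auto simp: separations_def oriented_sep_def)
qed (simp add: finite_ground)

text \<open>This is rank submodularity for \<open>A\<close>, \<open>C\<close> and for
  \<open>B\<close>, \<open>D\<close>, added up and regrouped: \<open>A \<inter> C\<close> is paired
  with \<open>B \<union> D\<close>, and \<open>B \<inter> D\<close> with
  \<open>A \<union> C\<close>.\<close>

lemma corner_order_submodular:
  assumes "oriented_sep A B" "oriented_sep C D"
  shows "sep_order (corner A B C D) + sep_order (corner B A D C)
    \<le> sep_order {A, B} + sep_order {C, D}"
  using rk_submodular[of A C] rk_submodular[of B D] assms
  by (simp add: corner_def sep_order_pair oriented_sep_corner oriented_sep_commute)

section \<open>Nestedness and crossing of corners\<close>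

lemma nestedI: "A \<subseteq> C \<Longrightarrow> D \<subseteq> B \<Longrightarrow> nested {A, B} {C, D}"
  unfolding nested_def by (intro exI conjI) (rule refl | assumption)+

text \<open>As the sides are complementary, an inclusion between sides is the same as disjointness
  from the other side. This removes the renaming of sides from all later arguments about
  crossing.\<close>

lemma nested_iff:
  assumes "oriented_sep A B" "oriented_sep C D"
  shows "nested {A, B} {C, D} \<longleftrightarrow>
    A \<inter> C = {} \<or> A \<inter> D = {} \<or> B \<inter> C = {} \<or> B \<inter> D = {}" (is "_ \<longleftrightarrow> ?R")
proof
  assume "nested {A, B} {C, D}"
  then obtain P Q S T where PQ: "{A, B} = {P, Q}" and ST: "{C, D} = {S, T}"
    and sub: "P \<subseteq> S" "T \<subseteq> Q" unfolding nested_def by (elim exE conjE)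
  have "A \<inter> B = {}" using assms by (simp add: oriented_sep_def)
  with PQ have "P \<inter> Q = {}" by (auto simp: doubleton_eq_iff)
  with sub have "P \<inter> T = {}" by blast
  moreover have "P = A \<or> P = B" "T = C \<or> T = D" using PQ ST by (auto simp: doubleton_eq_iff)
  ultimately show ?R by blast
next
  assume ?R
  then have "A \<subseteq> D \<and> C \<subseteq> B \<or> A \<subseteq> C \<and> D \<subseteq> B \<or> B \<subseteq> D \<and> C \<subseteq> A \<or> B \<subseteq> C \<and> D \<subseteq> A"
    using assms unfolding oriented_sep_iff by (elim disjE conjE) blast+
  then show "nested {A, B} {C, D}"
    using nestedI[of A D C B] nestedI[of A C D B] nestedI[of B D C A] nestedI[of B C D A]
    by (auto simp: insert_commute)
qed

lemma nested_commute: "nested s t \<longleftrightarrow> nested t s"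
proof -
  have "nested t s" if st: "nested s t" for s t
  proof -
    from st obtain A B C D where "s = {A, B}" "t = {C, D}" "A \<subseteq> C" "D \<subseteq> B"
      unfolding nested_def by (elim exE conjE)
    then show ?thesis using nestedI[of D B A C] by (simp add: insert_commute)
  qed
  then show ?thesis by blast
qed

text \<open>The separation \<open>t\<close> divides \<open>A \<inter> C\<close>, hence both
  \<open>A\<close> and \<open>C\<close>, so it is enough that \<open>t\<close> divides
  \<open>B\<close> or \<open>D\<close>. A point of \<open>B \<inter> D\<close>, which exists because
  the two given separations cross, lies on one side of \<open>t\<close>, and
  \<open>B \<union> D\<close> has a point on the other side.\<close>

lemma crosses_corner:
  assumes "oriented_sep A B" "oriented_sep C D" "t \<in> separations"
    and "crosses {A, B} {C, D}" "crosses (corner A B C D) t"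
  shows "crosses {A, B} t \<or> crosses {C, D} t"
proof -
  obtain G H where t: "t = {G, H}" "oriented_sep G H" using assms(3) by (rule separationsE)
  have "B \<inter> D \<noteq> {}" using assms(4) unfolding nested_iff[OF assms(1,2)] by simp
  then obtain z where z: "z \<in> B" "z \<in> D" by blast
  have cr: "A \<inter> C \<inter> G \<noteq> {}" "A \<inter> C \<inter> H \<noteq> {}" "(B \<union> D) \<inter> G \<noteq> {}" "(B \<union> D) \<inter> H \<noteq> {}"
    using assms(5) unfolding t(1) corner_def
      nested_iff[OF oriented_sep_corner[OF assms(1,2)] t(2)] by simp_all
  have "z \<in> G \<or> z \<in> H" using z assms(1) t(2) by (auto simp: oriented_sep_iff)
  then have "(B \<inter> G \<noteq> {} \<and> B \<inter> H \<noteq> {}) \<or> (D \<inter> G \<noteq> {} \<and> D \<inter> H \<noteq> {})"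
    using z cr(3,4) by blast
  with cr(1,2) show ?thesis
    unfolding t(1) nested_iff[OF assms(1) t(2)] nested_iff[OF assms(2) t(2)] by blast
qed

text \<open>Here \<open>t\<close> divides both \<open>A \<inter> C\<close> and
  \<open>B \<inter> D\<close>, hence all four sides.\<close>

lemma crosses_opposite_corners:
  assumes "oriented_sep A B" "oriented_sep C D" "t \<in> separations"
    and "crosses (corner A B C D) t" "crosses (corner B A D C) t"
  shows "crosses {A, B} t \<and> crosses {C, D} t"
proof -
  obtain G H where t: "t = {G, H}" "oriented_sep G H" using assms(3) by (rule separationsE)
  have os: "oriented_sep B A" "oriented_sep D C" using assms oriented_sep_commute by blast+
  have "A \<inter> C \<inter> G \<noteq> {}" "A \<inter> C \<inter> H \<noteq> {}" "B \<inter> D \<inter> G \<noteq> {}" "B \<inter> D \<inter> H \<noteq> {}"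
    using assms(4,5) unfolding t(1) corner_def
      nested_iff[OF oriented_sep_corner[OF assms(1,2)] t(2)]
      nested_iff[OF oriented_sep_corner[OF os] t(2)] by simp_all
  then show ?thesis
    unfolding t(1) nested_iff[OF assms(1) t(2)] nested_iff[OF assms(2) t(2)] by blast
qed

lemma corner_nested:
  assumes "oriented_sep A B" "oriented_sep C D"
  shows "nested (corner A B C D) {C, D}"
proof -
  have "A \<inter> C \<inter> D = {}" using assms(2) by (auto simp: oriented_sep_iff)
  then show ?thesis
    unfolding corner_def nested_iff[OF oriented_sep_corner[OF assms] assms(2)] by blast
qed

section \<open>Crossing numbers of opposite corners\<close>

definition entangled :: "'a set set set" where
  "entangled = {t. \<exists>\<epsilon>. entanglement \<epsilon> \<and> t \<in> \<epsilon>}"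

lemma entangled_subset: "entangled \<subseteq> separations"
  by (auto simp: entangled_def entanglement_def)

lemma crossing_number_eq: "crossing_number s = card {t \<in> entangled. crosses s t}"
  by (simp add: crossing_number_def entangled_def)

text \<open>For the sets of crossed entangled separations, the union over the two corners lies in
  the union over the two separations, and likewise for intersections. Adding the cardinalities gives
  the weak inequality. It is strict because \<open>{C, D}\<close> is crossed by
  \<open>{A, B}\<close> but by neither corner.\<close>

lemma crossing_number_corners:
  assumes rs: "oriented_sep A B" "oriented_sep C D" "crosses {A, B} {C, D}"
    and ent: "{C, D} \<in> entangled"
  shows "crossing_number (corner A B C D) + crossing_number (corner B A D C)
    < crossing_number {A, B} + crossing_number {C, D}"
proof -
  define X where "X s = {t \<in> entangled. crosses s t}" for s
  let ?r = "{A, B}" and ?s = "{C, D}" and ?c = "corner A B C D" and ?d = "corner B A D C"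
  have fin: "finite (X s)" for s
    using finite_subset[OF entangled_subset finite_separations] by (simp add: X_def)
  have rs': "oriented_sep B A" "oriented_sep D C" "crosses {B, A} {D, C}"
    using rs by (simp_all add: oriented_sep_commute insert_commute)
  have un: "X ?c \<union> X ?d \<subseteq> X ?r \<union> X ?s"
    using crosses_corner[OF rs(1,2) _ rs(3)] crosses_corner[OF rs'(1,2) _ rs'(3)] entangled_subset
    by (auto simp: X_def insert_commute)
  have "?s \<in> X ?r" using rs ent by (simp add: X_def)
  moreover have "?s \<notin> X ?c \<union> X ?d"
    using corner_nested[OF rs(1,2)] corner_nested[OF rs'(1,2)] by (simp add: X_def insert_commute)
  ultimately have "X ?c \<union> X ?d \<subset> X ?r \<union> X ?s" using un by blast
  then have 1: "card (X ?c \<union> X ?d) < card (X ?r \<union> X ?s)"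
    by (intro psubset_card_mono) (simp_all add: fin)
  have "X ?c \<inter> X ?d \<subseteq> X ?r \<inter> X ?s"
    using crosses_opposite_corners[OF rs(1,2)] entangled_subset by (auto simp: X_def)
  then have 2: "card (X ?c \<inter> X ?d) \<le> card (X ?r \<inter> X ?s)"
    by (intro card_mono) (simp_all add: fin)
  have "card (X ?c) + card (X ?d) < card (X ?r) + card (X ?s)"
    using 1 2 card_Un_Int[OF fin fin, of ?c ?d] card_Un_Int[OF fin fin, of ?r ?s] by simp
  then show ?thesis by (simp add: X_def crossing_number_eq)
qed

section \<open>Friendly separations are nested\<close>

lemma friendly_entangled: "friendly s \<Longrightarrow> s \<in> entangled"
  by (auto simp: friendly_def entangled_def)

text \<open>The corner comes from the entanglement that witnesses friendliness; since it lies in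
  that entanglement, the minimality of the crossing number of \<open>{A, B}\<close> applies to
  it.\<close>

lemma friendly_corner:
  assumes r: "friendly {A, B}" and s: "oriented_sep C D" and cr: "crosses {A, B} {C, D}"
    and le: "sep_order (corner A B C D) \<le> sep_order {A, B}"
      "sep_order (corner A B D C) \<le> sep_order {A, B}"
  shows "\<exists>c \<in> {corner A B C D, corner A B D C}.
    sep_order c = sep_order {A, B} \<and> crossing_number {A, B} \<le> crossing_number c"
proof -
  from r obtain \<epsilon> where \<epsilon>: "entanglement \<epsilon>" "{A, B} \<in> \<epsilon>"
    and "\<not> (\<exists>t\<in>\<epsilon>. t \<noteq> {A, B} \<and> crossing_number t < crossing_number {A, B})"
    unfolding friendly_def by blast
  then have min: "crossing_number {A, B} \<le> crossing_number t" if "t \<in> \<epsilon>" for t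
    using that by (cases "t = {A, B}") (auto simp: not_less)
  have "\<exists>c \<in> {corner A B C D, corner A B D C}. sep_order c = sep_order {A, B} \<and> c \<in> \<epsilon>"
    using \<epsilon> oriented_sep_in_separations[OF s] cr le unfolding entanglement_def by blast
  with min show ?thesis by blast
qed

theorem friendly_nested:
  assumes r: "friendly r" and s: "friendly s"
  shows "nested r s"
proof (rule ccontr)
  assume cr: "crosses r s"
  from r s have "r \<in> separations" "s \<in> separations"
    using friendly_entangled entangled_subset by blast+
  then obtain A B C D
    where rs: "r = {A, B}" "oriented_sep A B" "s = {C, D}" "oriented_sep C D"
    by (metis separationsE)
  have cross: "crosses {A, B} {C, D}" "crosses {B, A} {C, D}"
      "crosses {C, D} {A, B}" "crosses {D, C} {A, B}" "crosses {A, B} {D, C}"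
    using cr rs by (simp_all add: insert_commute nested_commute)
  have fr: "friendly {A, B}" "friendly {B, A}" "friendly {C, D}" "friendly {D, C}"
    using r s rs by (simp_all add: insert_commute)
  have ent: "{C, D} \<in> entangled" "{D, C} \<in> entangled"
    using fr friendly_entangled by blast+
  have os: "oriented_sep D C" using rs oriented_sep_commute by blast
  \<comment> \<open>Crossing numbers are cast to \<open>int\<close>, so that what follows becomes
    one problem of linear integer arithmetic.\<close>
  define o' x where "o' = sep_order" and "x = (\<lambda>s. int (crossing_number s))"
  define AC AD BC BD where "AC = corner A B C D" and "AD = corner A B D C"
    and "BC = corner B A C D" and "BD = corner B A D C"
  have sub: "o' AC + o' BD \<le> o' r + o' s" "o' AD + o' BC \<le> o' r + o' s"
    using corner_order_submodular[of A B C D] corner_order_submodular[of A B D C] rs os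
    unfolding o'_def AC_def AD_def BC_def BD_def by (simp_all add: insert_commute)
  have num: "x AC + x BD < x r + x s" "x AD + x BC < x r + x s"
    using crossing_number_corners[of A B C D] crossing_number_corners[of A B D C] rs os cross ent
    unfolding x_def AC_def AD_def BC_def BD_def
    by (simp_all add: insert_commute)
  \<comment> \<open>\<open>friendly_corner\<close> speaks of the first side of a pair, so each of
    the four sides needs its own ordering of \<open>r\<close> or \<open>s\<close>.\<close>
  have A: "o' AC \<le> o' r \<Longrightarrow> o' AD \<le> o' r \<Longrightarrow>
      o' AC = o' r \<and> x r \<le> x AC \<or> o' AD = o' r \<and> x r \<le> x AD"
    using friendly_corner[OF fr(1) rs(4) cross(1)]
    by (auto simp: o'_def x_def AC_def AD_def rs insert_commute)
  have B: "o' BC \<le> o' r \<Longrightarrow> o' BD \<le> o' r \<Longrightarrow>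
      o' BC = o' r \<and> x r \<le> x BC \<or> o' BD = o' r \<and> x r \<le> x BD"
    using friendly_corner[OF fr(2) rs(4) cross(2)]
    by (auto simp: o'_def x_def BC_def BD_def rs insert_commute)
  have C: "o' AC \<le> o' s \<Longrightarrow> o' BC \<le> o' s \<Longrightarrow>
      o' AC = o' s \<and> x s \<le> x AC \<or> o' BC = o' s \<and> x s \<le> x BC"
    using friendly_corner[OF fr(3) rs(2) cross(3)]
    by (auto simp: o'_def x_def AC_def BC_def rs insert_commute corner_commute[of C])
  have D: "o' AD \<le> o' s \<Longrightarrow> o' BD \<le> o' s \<Longrightarrow>
      o' AD = o' s \<and> x s \<le> x AD \<or> o' BD = o' s \<and> x s \<le> x BD"
    using friendly_corner[OF fr(4) rs(2) cross(4)]
    by (auto simp: o'_def x_def AD_def BD_def rs insert_commute corner_commute[of D])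
  \<comment> \<open>By symmetry let \<open>o' r \<le> o' s\<close>. If two opposite corners both
    have order above \<open>o' r\<close>, both are below \<open>o' s\<close>, and then
    \<open>C\<close> or \<open>D\<close> is violated. Otherwise each opposite pair has a corner of
    order at most \<open>o' r\<close>, and these two share a side. The implications then force
    \<open>o' r = o' s\<close> and two opposite corners whose crossing numbers are at least those of
    \<open>r\<close> and \<open>s\<close>, against \<open>num\<close>.\<close>
  show False using sub num A B C D by (smt (verit))
qed

section \<open>Tangles\<close>

lemma tangle_order:
  assumes "tangle k \<tau>" "(A, B) \<in> \<tau>"
  shows "oriented_sep A B \<and> sep_order {A, B} < int k"
proof -
  from assms(1) have "\<forall>(A, B)\<in>\<tau>. oriented_sep A B \<and> sep_order {A, B} < int k"
    unfolding tangle_def by (elim conjE)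
  from bspec[OF this assms(2)] show ?thesis by simp
qed

lemma tangle_orients:
  assumes "tangle k \<tau>" "oriented_sep A B" "sep_order {A, B} < int k"
  shows "(A, B) \<in> \<tau> \<or> (B, A) \<in> \<tau>"
proof -
  from assms(1) have "\<forall>A B. oriented_sep A B \<and> sep_order {A, B} < int k \<longrightarrow>
      (\<exists>!p. p \<in> {(A, B), (B, A)} \<and> p \<in> \<tau>)"
    unfolding tangle_def by (elim conjE)
  with assms(2,3) have "\<exists>!p. p \<in> {(A, B), (B, A)} \<and> p \<in> \<tau>" by simp
  then obtain p where "p \<in> {(A, B), (B, A)}" "p \<in> \<tau>" by (elim ex1E conjE)
  then show ?thesis by (elim insertE) simp_all
qed

lemma tangle_no_cover:
  assumes "tangle k \<tau>" "(A\<^sub>1, B\<^sub>1) \<in> \<tau>" "(A\<^sub>2, B\<^sub>2) \<in> \<tau>" "(A\<^sub>3, B\<^sub>3) \<in> \<tau>"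
  shows "A\<^sub>1 \<union> A\<^sub>2 \<union> A\<^sub>3 \<noteq> E"
proof -
  from assms(1) have "\<not> (\<exists>A\<^sub>1 B\<^sub>1 A\<^sub>2 B\<^sub>2 A\<^sub>3 B\<^sub>3.
      (A\<^sub>1, B\<^sub>1) \<in> \<tau> \<and> (A\<^sub>2, B\<^sub>2) \<in> \<tau> \<and> (A\<^sub>3, B\<^sub>3) \<in> \<tau> \<and> A\<^sub>1 \<union> A\<^sub>2 \<union> A\<^sub>3 = E)"
    unfolding tangle_def by (elim conjE)
  with assms(2-4) show ?thesis by metis
qed

text \<open>If \<open>(D, C)\<close> were in the tangle instead, then \<open>A\<close> and
  \<open>D\<close>, with \<open>D\<close> used twice, would cover \<open>E\<close>.\<close>

lemma tangle_subset:
  assumes \<tau>: "tangle k \<tau>" "(A, B) \<in> \<tau>"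
    and c: "oriented_sep C D" "sep_order {C, D} < int k" "C \<subseteq> A"
  shows "(C, D) \<in> \<tau>"
proof (rule ccontr)
  assume "(C, D) \<notin> \<tau>"
  then have "(D, C) \<in> \<tau>" using tangle_orients[OF \<tau>(1) c(1,2)] by blast
  from tangle_no_cover[OF \<tau> this this] have "A \<union> D \<noteq> E" by simp
  moreover have "D = E - C" "C \<subseteq> A" "A \<subseteq> E"
    using c tangle_order[OF \<tau>] by (simp_all add: oriented_sep_iff)
  ultimately show False by blast
qed

lemma distinguishes_commute: "distinguishes s \<tau> \<tau>' \<longleftrightarrow> distinguishes s \<tau>' \<tau>"
  unfolding distinguishes_def by blast

text \<open>Both corners inside \<open>X\<close> are small in \<open>\<tau>\<close>, but they cannot both be small in \<open>\<tau>'\<close>.\<close>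

lemma corner_distinguishes:
  assumes \<tau>: "tangle k \<tau>" "(X, X') \<in> \<tau>" and \<tau>': "tangle l \<tau>'" "(X', X) \<in> \<tau>'"
    and s: "oriented_sep Y Y'"
    and le: "sep_order (corner X X' Y Y') \<le> sep_order {X, X'}"
      "sep_order (corner X X' Y' Y) \<le> sep_order {X, X'}"
  shows "\<exists>c \<in> {corner X X' Y Y', corner X X' Y' Y}. distinguishes c \<tau> \<tau>'"
proof -
  have X: "oriented_sep X X'" "sep_order {X, X'} < int k" "sep_order {X, X'} < int l"
    using tangle_order[OF \<tau>] tangle_order[OF \<tau>'] by (simp_all add: insert_commute)
  have s': "oriented_sep Y' Y" using s oriented_sep_commute by blast
  note os = oriented_sep_corner[OF X(1) s] oriented_sep_corner[OF X(1) s']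
  note le' = le[unfolded corner_def]
  have in_\<tau>: "(X \<inter> Y, X' \<union> Y') \<in> \<tau>" "(X \<inter> Y', X' \<union> Y) \<in> \<tau>"
    using tangle_subset[OF \<tau> os(1)] tangle_subset[OF \<tau> os(2)] le' X by auto
  have "X' \<union> (X \<inter> Y) \<union> (X \<inter> Y') = E" using X(1) s by (auto simp: oriented_sep_iff)
  then have "\<not> ((X \<inter> Y, X' \<union> Y') \<in> \<tau>' \<and> (X \<inter> Y', X' \<union> Y) \<in> \<tau>')"
    using tangle_no_cover[OF \<tau>'] by blast
  then have "(X' \<union> Y', X \<inter> Y) \<in> \<tau>' \<or> (X' \<union> Y, X \<inter> Y') \<in> \<tau>'"
    using tangle_orients[OF \<tau>'(1) os(1)] tangle_orients[OF \<tau>'(1) os(2)] le' X by linarith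
  with in_\<tau> os show ?thesis unfolding corner_def distinguishes_def by blast
qed

text \<open>When both corners on one side have order at most that of the given separation, one of
  them distinguishes the tangles. Efficiency bounds its order from below, so the orders agree and
  the corner is itself efficient.\<close>

lemma entanglement_efficient_distinguishers:
  assumes \<tau>: "tangle k \<tau>" and \<tau>': "tangle l \<tau>'" and dist: "distinguishable \<tau> \<tau>'"
  shows "entanglement {s. efficiently_distinguishes s \<tau> \<tau>'}" (is "entanglement ?\<epsilon>")
proof -
  let ?D = "{s. distinguishes s \<tau> \<tau>'}"
  have D: "?D \<subseteq> separations"
    unfolding distinguishes_def using oriented_sep_in_separations by blast
  then have "finite ?D" using finite_separations by (rule finite_subset)
  moreover have "?D \<noteq> {}" using dist by (simp add: distinguishable_def)
  ultimately have "\<exists>s. is_arg_min sep_order (\<lambda>s. s \<in> ?D) s"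
    by (rule ex_is_arg_min_if_finite)
  then obtain s where "efficiently_distinguishes s \<tau> \<tau>'"
    by (auto simp: is_arg_min_linorder efficiently_distinguishes_def)
  then have ne: "?\<epsilon> \<noteq> {}" by blast
  have sub: "?\<epsilon> \<subseteq> separations" using D by (auto simp: efficiently_distinguishes_def)
  have corners:
    "\<exists>c \<in> {corner X X' Y Y', corner X X' Y' Y}. sep_order c = sep_order {X, X'} \<and> c \<in> ?\<epsilon>"
    if r: "{X, X'} \<in> ?\<epsilon>" and s: "{Y, Y'} \<in> separations"
      and le: "sep_order (corner X X' Y Y') \<le> sep_order {X, X'}"
        "sep_order (corner X X' Y' Y) \<le> sep_order {X, X'}"
    for X X' Y Y'
  proof -
    note Y = oriented_sep_of_separations[OF s]
    have r': "distinguishes {X, X'} \<tau> \<tau>'"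
      "\<And>t. distinguishes t \<tau> \<tau>' \<Longrightarrow> sep_order {X, X'} \<le> sep_order t"
      using r by (simp_all add: efficiently_distinguishes_def)
    from r'(1) obtain A B where "{X, X'} = {A, B}"
      "(A, B) \<in> \<tau> \<and> (B, A) \<in> \<tau>' \<or> (B, A) \<in> \<tau> \<and> (A, B) \<in> \<tau>'"
      unfolding distinguishes_def by (elim exE conjE)
    then have "(X, X') \<in> \<tau> \<and> (X', X) \<in> \<tau>' \<or> (X, X') \<in> \<tau>' \<and> (X', X) \<in> \<tau>"
      unfolding doubleton_eq_iff by (elim disjE conjE) simp_all
    then have "\<exists>c \<in> {corner X X' Y Y', corner X X' Y' Y}. distinguishes c \<tau> \<tau>'"
    proof (elim disjE conjE)
      assume "(X, X') \<in> \<tau>" "(X', X) \<in> \<tau>'"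
      then show ?thesis by (rule corner_distinguishes[OF \<tau> _ \<tau>' _ Y le])
    next
      assume "(X, X') \<in> \<tau>'" "(X', X) \<in> \<tau>"
      then show ?thesis
        unfolding distinguishes_commute[of _ \<tau> \<tau>'] by (rule corner_distinguishes[OF \<tau>' _ \<tau> _ Y le])
    qed
    then obtain c where c: "c \<in> {corner X X' Y Y', corner X X' Y' Y}" "distinguishes c \<tau> \<tau>'"
      by (elim bexE)
    have "sep_order c \<le> sep_order {X, X'}" using c(1) le by (elim insertE) simp_all
    with r'(2)[OF c(2)] have "sep_order c = sep_order {X, X'}" by simp
    with c r'(2) show ?thesis
      by (intro bexI[OF _ c(1)]) (simp add: efficiently_distinguishes_def)
  qed
  show ?thesis
    unfolding entanglement_def
  proof (intro conjI ballI impI allI ne sub)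
    fix r s X X' Y Y'
    assume "r \<in> ?\<epsilon>" "s \<in> separations" and *: "r = {X, X'} \<and> s = {Y, Y'} \<and>
      sep_order (corner X X' Y Y') \<le> sep_order r \<and> sep_order (corner X X' Y' Y) \<le> sep_order r"
    from * have r: "r = {X, X'}" and s: "s = {Y, Y'}" by simp_all
    from * have le: "sep_order (corner X X' Y Y') \<le> sep_order {X, X'}"
      "sep_order (corner X X' Y' Y) \<le> sep_order {X, X'}" unfolding r by auto
    show "\<exists>c \<in> {corner X X' Y Y', corner X X' Y' Y}. sep_order c = sep_order r \<and> c \<in> ?\<epsilon>"
      unfolding r
      using \<open>r \<in> ?\<epsilon>\<close> \<open>s \<in> separations\<close> le unfolding r s by (rule corners)
  qed
qed

lemma friendly_efficiently_distinguishes: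
  assumes "tangle k \<tau>" "tangle l \<tau>'" "distinguishable \<tau> \<tau>'"
  shows "\<exists>s. friendly s \<and> efficiently_distinguishes s \<tau> \<tau>'"
proof -
  let ?\<epsilon> = "{s. efficiently_distinguishes s \<tau> \<tau>'}"
  note ent = entanglement_efficient_distinguishers[OF assms]
  then have \<epsilon>: "?\<epsilon> \<noteq> {}" "?\<epsilon> \<subseteq> separations" unfolding entanglement_def by simp_all
  have "\<exists>s. is_arg_min crossing_number (\<lambda>s. s \<in> ?\<epsilon>) s"
    using finite_subset[OF \<epsilon>(2) finite_separations] \<epsilon>(1) by (rule ex_is_arg_min_if_finite)
  then obtain s where s: "is_arg_min crossing_number (\<lambda>s. s \<in> ?\<epsilon>) s" by (elim exE)
  then have "s \<in> ?\<epsilon>" "\<not> (\<exists>t\<in>?\<epsilon>. t \<noteq> s \<and> crossing_number t < crossing_number s)"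
    by (auto simp: is_arg_min_def)
  with ent have "friendly s"
    unfolding friendly_def by (intro exI[of _ ?\<epsilon>] conjI)
  with \<open>s \<in> ?\<epsilon>\<close> show ?thesis by (intro exI[of _ s]) simp
qed

end

section \<open>Attaching a leaf to a tree\<close>

text \<open>Sending the leaf \<open>w\<close> to its neighbour \<open>v\<close> retracts the larger
  graph onto the old one: the new edge collapses to a point, so paths project to paths.\<close>

lemma reachable_insert_leaf:
  assumes w: "w \<notin> \<Union>F" and vw: "v \<noteq> w" and u: "u \<noteq> w"
  shows "(u, y) \<in> {(x, y). {x, y} \<in> insert {v, w} F}\<^sup>* \<longleftrightarrow>
    (u, if y = w then v else y) \<in> {(x, y). {x, y} \<in> F}\<^sup>*" (is "_ \<in> ?R'\<^sup>* \<longleftrightarrow> _ \<in> ?R\<^sup>*")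
proof
  assume "(u, y) \<in> ?R'\<^sup>*"
  then show "(u, if y = w then v else y) \<in> ?R\<^sup>*"
  proof (induction rule: rtrancl_induct)
    case base
    then show ?case using u by simp
  next
    case (step y z)
    have "{y, z} = {v, w} \<or> {y, z} \<in> F \<and> y \<noteq> w \<and> z \<noteq> w" using step w by auto
    then show ?case
    proof
      assume "{y, z} = {v, w}"
      then show ?thesis using step.IH by (auto simp: doubleton_eq_iff split: if_splits)
    next
      assume "{y, z} \<in> F \<and> y \<noteq> w \<and> z \<noteq> w"
      then show ?thesis using step.IH by (auto intro: rtrancl_into_rtrancl)
    qed
  qed
next
  have "?R \<subseteq> ?R'" by auto
  then have "?R\<^sup>* \<subseteq> ?R'\<^sup>*" by (rule rtrancl_mono)
  moreover assume "(u, if y = w then v else y) \<in> ?R\<^sup>*"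
  ultimately show "(u, y) \<in> ?R'\<^sup>*"
    by (auto split: if_splits intro: rtrancl_into_rtrancl)
qed

lemma graph_component_insert_leaf:
  assumes "w \<notin> \<Union>F" "v \<in> V" "w \<notin> V" "u \<in> V"
  shows "graph_component (insert w V) (insert {v, w} F) u =
    {y \<in> insert w V. (if y = w then v else y) \<in> graph_component V F u}"
proof -
  have "v \<noteq> w" "u \<noteq> w" using assms by auto
  note * = reachable_insert_leaf[OF assms(1) this]
  show ?thesis using assms(2) unfolding graph_component_def * by auto
qed

lemma reachable_symmetric:
  "(u, v) \<in> {(x, y). {x, y} \<in> F}\<^sup>* \<Longrightarrow> (v, u) \<in> {(x, y). {x, y} \<in> F}\<^sup>*"
  by (rule symD[OF sym_rtrancl]) (auto simp: sym_def insert_commute)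

lemma graph_component_eq:
  assumes "v \<in> graph_component V F u"
  shows "graph_component V F v = graph_component V F u"
  using assms reachable_symmetric[of u v F]
  by (auto simp: graph_component_def intro: rtrancl_trans)

text \<open>The new components are the preimages of the old ones under that retraction;
  \<open>w\<close> joins the component of \<open>v\<close> and adds none. This is later applied with
  an old edge deleted.\<close>

lemma graph_components_insert_leaf:
  assumes "w \<notin> \<Union>F" "v \<in> V" "w \<notin> V"
  shows "graph_components (insert w V) (insert {v, w} F) =
    (\<lambda>C. {y \<in> insert w V. (if y = w then v else y) \<in> C}) ` graph_components V F"
proof -
  have "v \<in> graph_component V F v" using assms by (simp add: graph_component_def)
  then have "w \<in> graph_component (insert w V) (insert {v, w} F) v"
    by (subst graph_component_insert_leaf) (use assms in auto)
  from graph_component_eq[OF this]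
  have "graph_components (insert w V) (insert {v, w} F) =
      graph_component (insert w V) (insert {v, w} F) ` V"
    using assms by (auto simp: graph_components_def)
  also have "\<dots> = (\<lambda>C. {y \<in> insert w V. (if y = w then v else y) \<in> C}) ` graph_components V F"
    unfolding graph_components_def image_image
    by (intro image_cong refl graph_component_insert_leaf assms)
  finally show ?thesis .
qed

lemma graph_component_isolated:
  assumes "w \<notin> \<Union>F"
  shows "graph_component (insert w V) F w = {w}"
proof -
  have "y = w" if "(w, y) \<in> {(x, y). {x, y} \<in> F}\<^sup>*" for y
    using that assms by (induction rule: rtrancl_induct) auto
  then show ?thesis by (auto simp: graph_component_def)
qed

text \<open>Deleting the leaf edge leaves the leaf isolated. This covers the other components in
  that case.\<close>

lemma graph_component_add_isolated:
  assumes "w \<notin> \<Union>F" "u \<noteq> w"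
  shows "graph_component (insert w V) F u = graph_component V F u"
proof -
  have "(u, w) \<notin> {(x, y). {x, y} \<in> F}\<^sup>*"
    using assms by (auto elim: rtranclE)
  then show ?thesis by (auto simp: graph_component_def)
qed

text \<open>A vertex on a cycle has two distinct neighbours there, whereas \<open>v\<close> is the
  only neighbour of \<open>w\<close>.\<close>

lemma graph_cycle_avoids_leaf:
  assumes cyc: "graph_cycle (insert {v, w} F) xs" and w: "w \<notin> \<Union>F" and vw: "v \<noteq> w"
  shows "graph_cycle F xs"
proof -
  let ?n = "length xs"
  have n: "3 \<le> ?n" and d: "distinct xs"
    and e: "\<And>i. i < ?n \<Longrightarrow> {xs ! i, xs ! (Suc i mod ?n)} \<in> insert {v, w} F"
    using cyc by (auto simp: graph_cycle_def)
  have nb: "y = v" if "{w, y} \<in> insert {v, w} F" for y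
    using that w vw by (auto simp: doubleton_eq_iff)
  have "w \<notin> set xs"
  proof
    assume "w \<in> set xs"
    then obtain i where i: "i < ?n" "xs ! i = w" by (auto simp: in_set_conv_nth)
    \<comment> \<open>\<open>j\<close> and \<open>k\<close> are the cyclic predecessor and successor
      of \<open>i\<close>; they differ because the length is at least 3.\<close>
    define j where "j = (if i = 0 then ?n - 1 else i - 1)"
    define k where "k = (if Suc i = ?n then 0 else Suc i)"
    have jk: "j < ?n" "k < ?n" "Suc j mod ?n = i" "Suc i mod ?n = k" "j \<noteq> k"
      using i n by (auto simp: j_def k_def)
    have "xs ! k = v" using nb e[OF i(1)] i jk by simp
    moreover have "xs ! j = v" using nb e[OF jk(1)] i jk by (simp add: insert_commute)
    ultimately show False using d jk by (simp add: nth_eq_iff_index_eq[symmetric])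
  qed
  moreover have "Suc i mod ?n < ?n" for i using n by (intro mod_less_divisor) linarith
  ultimately have "{xs ! i, xs ! (Suc i mod ?n)} \<in> F" if "i < ?n" for i
    using e[OF that] that nth_mem by (fastforce simp: doubleton_eq_iff)
  then show ?thesis using n d by (simp add: graph_cycle_def)
qed

lemma graph_tree_edges_subset: "graph_tree V F \<Longrightarrow> \<Union>F \<subseteq> V"
  by (auto simp: graph_tree_def simple_graph_def)

lemma graph_tree_insert_leaf:
  assumes T: "graph_tree V F" and v: "v \<in> V" and w: "w \<notin> V"
  shows "graph_tree (insert w V) (insert {v, w} F)"
proof -
  have wF: "w \<notin> \<Union>F" using graph_tree_edges_subset[OF T] w by blast
  have vw: "v \<noteq> w" using v w by blast
  have conn: "graph_component V F u = V" if "u \<in> V" for u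
    using T that by (simp add: graph_tree_def)
  then have "graph_components V F = {V}" using v by (auto simp: graph_components_def)
  then have "graph_components (insert w V) (insert {v, w} F) = {insert w V}"
    using graph_components_insert_leaf[OF wF v w] v by auto
  then have "graph_component (insert w V) (insert {v, w} F) u = insert w V"
    if "u \<in> insert w V" for u
    using that unfolding graph_components_def by blast
  moreover have "\<not> graph_cycle (insert {v, w} F) xs" for xs
    using graph_cycle_avoids_leaf[OF _ wF vw] T by (auto simp: graph_tree_def)
  moreover have "simple_graph (insert w V) (insert {v, w} F)"
    using T v vw by (auto simp: graph_tree_def simple_graph_def)
  ultimately show ?thesis by (simp add: graph_tree_def)
qed

section \<open>The tree of a nested set of separations\<close>

context matroid
begin

text \<open>Moving \<open>A\<close> from \<open>v\<close> to the leaf \<open>w\<close> changes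
  nothing for an old edge, since \<open>v\<close> and \<open>w\<close> stay in the same component
  when that edge is deleted.\<close>

lemma induced_sep_insert_leaf:
  assumes T: "graph_tree V F" and v: "v \<in> V" and w: "w \<notin> V"
    and \<phi>: "\<And>x. x \<in> E \<Longrightarrow> \<phi> x \<in> V" "\<And>x. x \<in> A \<Longrightarrow> \<phi> x = v" and e: "e \<in> F"
  shows "induced_sep (insert w V) (insert {v, w} F) (\<lambda>x. if x \<in> A then w else \<phi> x) e
    = induced_sep V F \<phi> e"
proof -
  have wF: "w \<notin> \<Union>F" using graph_tree_edges_subset[OF T] w by blast
  then have F: "insert {v, w} F - {e} = insert {v, w} (F - {e})" using e by blast
  have "w \<notin> \<Union>(F - {e})" using wF by blast
  note comps = graph_components_insert_leaf[OF this v w]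
  have "{x \<in> E. (if x \<in> A then w else \<phi> x) \<in> {y \<in> insert w V. (if y = w then v else y) \<in> C}}
      = {x \<in> E. \<phi> x \<in> C}" for C
  proof (intro Collect_cong conj_cong refl)
    fix x assume "x \<in> E"
    then have "\<phi> x \<in> V" "\<phi> x \<noteq> w" using \<phi>(1) w by auto
    then show "(if x \<in> A then w else \<phi> x) \<in> {y \<in> insert w V. (if y = w then v else y) \<in> C}
        \<longleftrightarrow> \<phi> x \<in> C" using \<phi>(2)[of x] by simp
  qed
  then show ?thesis unfolding induced_sep_def F comps image_image by (intro image_cong refl)
qed

lemma induced_sep_leaf:
  assumes T: "graph_tree V F" and v: "v \<in> V" and w: "w \<notin> V"
    and \<phi>: "\<And>x. x \<in> E \<Longrightarrow> \<phi> x \<in> V" and A: "oriented_sep A B"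
  shows "induced_sep (insert w V) (insert {v, w} F) (\<lambda>x. if x \<in> A then w else \<phi> x) {v, w}
    = {A, B}"
proof -
  have wF: "w \<notin> \<Union>F" using graph_tree_edges_subset[OF T] w by blast
  then have F: "insert {v, w} F - {{v, w}} = F" by blast
  have "graph_component (insert w V) F u = V" if "u \<in> V" for u
  proof -
    have "u \<noteq> w" using that w by blast
    with T that show ?thesis by (simp add: graph_component_add_isolated[OF wF] graph_tree_def)
  qed
  then have "graph_component (insert w V) F ` V = {V}" using v by force
  then have comps: "graph_components (insert w V) F = {{w}, V}"
    by (simp add: graph_components_def graph_component_isolated[OF wF])
  have "A \<subseteq> E" "B = E - A" using A by (simp_all add: oriented_sep_iff)
  then have "{x \<in> E. (if x \<in> A then w else \<phi> x) \<in> {w}} = A"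
    "{x \<in> E. (if x \<in> A then w else \<phi> x) \<in> V} = B"
    using w \<phi> by (auto split: if_splits)
  then show ?thesis unfolding induced_sep_def F comps by simp
qed

text \<open>\<open>A\<close> is inclusion-minimal among all sides of members of \<open>N\<close>.
  Nestedness makes \<open>A\<close> comparable with a side of \<open>t\<close>, and minimality turns
  a side inside \<open>A\<close> into \<open>A\<close> itself. No other member of \<open>N\<close>
  therefore divides \<open>A\<close>, which can become the part of a leaf.\<close>

lemma minimal_side:
  assumes N: "nested_set N" "N \<noteq> {}"
  obtains A B where "{A, B} \<in> N" "oriented_sep A B"
    "\<And>t. t \<in> N - {{A, B}} \<Longrightarrow> \<exists>C\<in>t. A \<subseteq> C"
proof -
  have sub: "N \<subseteq> separations" using N by (simp add: nested_set_def)
  have N_pair: thesis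
    if s: "s \<in> N" and *: "\<And>P Q. s = {P, Q} \<Longrightarrow> oriented_sep P Q \<Longrightarrow> thesis" for s thesis
  proof -
    have "s \<in> separations" using sub s by (rule subsetD)
    then show thesis by (rule separationsE) (rule *)
  qed
  have N_side: "\<exists>B. s = {A, B} \<and> oriented_sep A B" if s: "s \<in> N" and A: "A \<in> s" for s A
  proof -
    obtain P Q where PQ: "s = {P, Q}" "oriented_sep P Q" using s by (rule N_pair)
    then have "s = {Q, P}" "oriented_sep Q P" by (simp_all add: insert_commute oriented_sep_commute)
    moreover have "A = P \<or> A = Q" using A PQ(1) by simp
    ultimately show ?thesis using PQ by metis
  qed
  have "\<Union>N \<subseteq> Pow E"
  proof
    fix X assume "X \<in> \<Union>N"
    then obtain s where "s \<in> N" "X \<in> s" by (elim UnionE)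
    then show "X \<in> Pow E" using N_side[of s X] by (auto simp: oriented_sep_iff)
  qed
  then have fin: "finite (\<Union>N)" by (rule finite_subset) (simp add: finite_ground)
  obtain s where "s \<in> N" using N(2) by blast
  moreover from this obtain P Q where "s = {P, Q}" by (rule N_pair)
  ultimately have "P \<in> \<Union>N" by blast
  then have "\<Union>N \<noteq> {}" by blast
  from finite_has_minimal[OF fin this]
  obtain A where A: "A \<in> \<Union>N" "\<forall>C\<in>\<Union>N. C \<subseteq> A \<longrightarrow> A = C" by (elim bexE)
  from A(1) obtain s where s: "s \<in> N" "A \<in> s" by (elim UnionE)
  obtain B where B: "s = {A, B}" "oriented_sep A B" using N_side[OF s] by (elim exE conjE)
  have "\<exists>C\<in>t. A \<subseteq> C" if t: "t \<in> N - {{A, B}}" for t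
  proof -
    from t have "t \<in> N" "s \<noteq> t" using B(1) by auto
    obtain C D where CD: "t = {C, D}" "oriented_sep C D" using \<open>t \<in> N\<close> by (rule N_pair)
    have "pairwise nested N" using N(1) by (simp add: nested_set_def)
    from pairwiseD[OF this s(1) \<open>t \<in> N\<close> \<open>s \<noteq> t\<close>] have "nested {A, B} {C, D}"
      by (simp only: B CD)
    then have "A \<subseteq> C \<or> A \<subseteq> D \<or> C \<subseteq> A \<or> D \<subseteq> A"
      using B(2) CD(2) unfolding nested_iff[OF B(2) CD(2)] oriented_sep_iff
      by (elim disjE conjE) blast+
    moreover have "C \<in> \<Union>N" "D \<in> \<Union>N" using \<open>t \<in> N\<close> CD(1) by auto
    then have "C \<subseteq> A \<Longrightarrow> A = C" "D \<subseteq> A \<Longrightarrow> A = D" using A(2) by blast+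
    ultimately show ?thesis unfolding CD(1) by auto
  qed
  with that s B show ?thesis by simp
qed

text \<open>
  That any two vertices are separated by an edge is what forces \<open>\<phi>\<close> to be constant on a set of
  elements which no separation in \<open>N\<close> divides.
\<close>

lemma ex_tree_of_nested_set:
  assumes "nested_set N"
  shows "\<exists>(V :: nat set) F \<phi>. tree_decomposition V F \<phi> \<and> finite V \<and>
    bij_betw (induced_sep V F \<phi>) F N \<and>
    (\<forall>u\<in>V. \<forall>v\<in>V. u \<noteq> v \<longrightarrow> (\<exists>e\<in>F. v \<notin> graph_component V (F - {e}) u))"
proof -
  have "finite N"
    using assms finite_separations finite_subset unfolding nested_set_def by blast
  then show ?thesis using assms
  proof (induction N rule: finite_psubset_induct)
    case (psubset N)
    show ?case
    proof (cases "N = {}")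
      case True
      have "graph_tree {0 :: nat} {}"
        by (auto simp: graph_tree_def simple_graph_def graph_component_def graph_cycle_def
            intro!: exI[of _ 0])
      then show ?thesis using True
        by (intro exI[of _ "{0}"] exI[of _ "{}"] exI[of _ "\<lambda>_. 0"])
          (auto simp: tree_decomposition_def bij_betw_def)
    next
      case False
      then obtain A B where AB: "{A, B} \<in> N" "oriented_sep A B"
        and side: "\<And>t. t \<in> N - {{A, B}} \<Longrightarrow> \<exists>C\<in>t. A \<subseteq> C"
        using minimal_side psubset.prems by metis
      let ?N = "N - {{A, B}}"
      have "nested_set ?N"
        using psubset.prems by (auto simp: nested_set_def pairwise_def)
      then obtain V :: "nat set" and F \<phi> where td: "tree_decomposition V F \<phi>" and fin: "finite V"
        and bij: "bij_betw (induced_sep V F \<phi>) F ?N"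
        and sep: "\<And>u v. u \<in> V \<Longrightarrow> v \<in> V \<Longrightarrow> u \<noteq> v \<Longrightarrow>
          \<exists>e\<in>F. v \<notin> graph_component V (F - {e}) u"
        using psubset.IH[of ?N] AB(1) by blast
      have T: "graph_tree V F" and \<phi>V: "\<And>x. x \<in> E \<Longrightarrow> \<phi> x \<in> V"
        using td by (auto simp: tree_decomposition_def)
      have AE: "A \<subseteq> E" using AB by (auto simp: oriented_sep_def)
      \<comment> \<open>An edge separating \<open>\<phi> x\<close> from \<open>\<phi> y\<close>
        would induce a member of \<open>?N\<close>, one of whose sides contains all of
        \<open>A\<close>, so both vertices would lie in one component after all.\<close>
      have const: "\<phi> x = \<phi> y" if xy: "x \<in> A" "y \<in> A" for x y
      proof (rule ccontr)
        assume "\<phi> x \<noteq> \<phi> y"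
        with sep \<phi>V xy AE obtain e
          where e: "e \<in> F" "\<phi> y \<notin> graph_component V (F - {e}) (\<phi> x)" by blast
        then have "induced_sep V F \<phi> e \<in> ?N" using bij by (auto simp: bij_betw_def)
        with side obtain C where C: "C \<in> induced_sep V F \<phi> e" "A \<subseteq> C" by blast
        then obtain u where u: "C = {z \<in> E. \<phi> z \<in> graph_component V (F - {e}) u}"
          by (auto simp: induced_sep_def graph_components_def)
        have "\<phi> x \<in> graph_component V (F - {e}) u" "\<phi> y \<in> graph_component V (F - {e}) u"
          using C(2) u xy by auto
        then show False using graph_component_eq e(2) by metis
      qed
      \<comment> \<open>The leaf is attached at the vertex to which all of \<open>A\<close> is
        mapped; for empty \<open>A\<close> any vertex will do.\<close>
      obtain v where v: "v \<in> V" "\<And>x. x \<in> A \<Longrightarrow> \<phi> x = v"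
      proof (cases "A = {}")
        case True
        then show ?thesis using that T by (auto simp: graph_tree_def)
      next
        case False
        then obtain a where "a \<in> A" by blast
        then show ?thesis using that[of "\<phi> a"] const \<phi>V AE by blast
      qed
      \<comment> \<open>The induction carries finiteness of \<open>V\<close> in order to provide
        this fresh natural number.\<close>
      obtain w where w: "w \<notin> V" using fin ex_new_if_finite by blast
      let ?V = "insert w V" and ?F = "insert {v, w} F"
      let ?\<phi> = "\<lambda>x. if x \<in> A then w else \<phi> x"
      have wF: "w \<notin> \<Union>F" using graph_tree_edges_subset[OF T] w by blast
      then have fF: "{v, w} \<notin> F" by blast
      have bij1: "bij_betw (induced_sep ?V ?F ?\<phi>) F ?N"
        by (rule bij_betw_cong[THEN iffD2, OF _ bij])
          (rule induced_sep_insert_leaf[OF T v(1) w \<phi>V v(2)])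
      have leaf: "induced_sep ?V ?F ?\<phi> {v, w} = {A, B}"
        by (rule induced_sep_leaf[OF T v(1) w \<phi>V AB(2)])
      have "bij_betw (induced_sep ?V ?F ?\<phi>) (F \<union> {{v, w}}) (?N \<union> {{A, B}})"
        unfolding leaf[symmetric]
        by (rule notIn_Un_bij_betw[OF fF _ bij1[folded leaf]]) simp
      moreover have "?N \<union> {{A, B}} = N" "F \<union> {{v, w}} = ?F" using AB(1) by auto
      ultimately have bij': "bij_betw (induced_sep ?V ?F ?\<phi>) ?F N" by simp
      have td': "tree_decomposition ?V ?F ?\<phi>"
        using graph_tree_insert_leaf[OF T v(1) w] \<phi>V by (auto simp: tree_decomposition_def)
      have F: "?F - {{v, w}} = F" using fF by blast
      \<comment> \<open>The new edge separates \<open>w\<close> from every other vertex; two old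
        vertices keep the old edge that separates them.\<close>
      have sep': "\<exists>e\<in>?F. u' \<notin> graph_component ?V (?F - {e}) u"
        if u: "u \<in> ?V" "u' \<in> ?V" "u \<noteq> u'" for u u'
      proof (cases "u = w \<or> u' = w")
        case True
        then have "u' \<notin> graph_component ?V (?F - {{v, w}}) u"
        proof (cases "u = w")
          case True
          with u show ?thesis unfolding F by (simp add: graph_component_isolated[OF wF])
        next
          case False
          have "graph_component V F u \<subseteq> V" by (auto simp: graph_component_def)
          with False \<open>u = w \<or> u' = w\<close> w show ?thesis
            unfolding F by (auto simp: graph_component_add_isolated[OF wF])
        qed
        then show ?thesis by blast
      next
        case False
        then obtain e where e: "e \<in> F" "u' \<notin> graph_component V (F - {e}) u"
          using sep u by blast
        then have "?F - {e} = insert {v, w} (F - {e})" using fF by blast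
        then have "u' \<notin> graph_component ?V (?F - {e}) u"
          using graph_component_insert_leaf[of w "F - {e}" v V u] wF v(1) w u e False by auto
        then show ?thesis using e by blast
      qed
      show ?thesis using td' bij' sep' fin by (intro exI[of _ ?V] exI[of _ ?F] exI[of _ ?\<phi>]) auto
    qed
  qed
qed

end

text \<open>The tree is the one built from the nested set of friendly separations. Any two
  distinguishable tangles, possibly of different orders, have a friendly efficient distinguisher,
  and the bijection makes it the separation induced by some edge.\<close>

theorem theorem5p4:
  fixes E :: "'a set" and indep :: "'a set \<Rightarrow> bool"
  assumes "matroid E indep"
  shows "matroid.nested_set E {s. matroid.friendly E indep s} \<and>
    (\<exists>(V :: nat set) F \<phi>.
       matroid.tree_decomposition E V F \<phi> \<and>
       bij_betw (matroid.induced_sep E V F \<phi>) F {s. matroid.friendly E indep s} \<and>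
       (\<forall>k l \<tau> \<tau>'. matroid.tangle E indep k \<tau> \<and> matroid.tangle E indep l \<tau>' \<and>
          matroid.distinguishable E \<tau> \<tau>' \<longrightarrow>
          matroid.td_efficiently_distinguishes E indep V F \<phi> \<tau> \<tau>'))"
proof -
  interpret matroid E indep by (rule assms)
  have nested: "nested_set {s. friendly s}"
    unfolding nested_set_def pairwise_def
    using friendly_nested friendly_entangled entangled_subset by blast
  then obtain V :: "nat set" and F \<phi> where td: "tree_decomposition V F \<phi>"
    and bij: "bij_betw (induced_sep V F \<phi>) F {s. friendly s}"
    using ex_tree_of_nested_set by blast
  have "td_efficiently_distinguishes V F \<phi> \<tau> \<tau>'"
    if "tangle k \<tau>" "tangle l \<tau>'" "distinguishable \<tau> \<tau>'" for k l \<tau> \<tau>'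
  proof -
    obtain s where s: "friendly s" "efficiently_distinguishes s \<tau> \<tau>'"
      using friendly_efficiently_distinguishes \<open>tangle k \<tau>\<close> \<open>tangle l \<tau>'\<close>
        \<open>distinguishable \<tau> \<tau>'\<close> by blast
    then have "s \<in> induced_sep V F \<phi> ` F" using bij by (simp add: bij_betw_def)
    with s show ?thesis by (auto simp: td_efficiently_distinguishes_def)
  qed
  with nested td bij show ?thesis by blast
qed

end
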